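(* Let $G=(\mathcal V,\mathcal E)$ be a locally finite unweighted graph ($m_0\equiv1$, and $m_1\equiv1$ on edges), and let $L(G)$ be its line graph, with maximal degree $\Delta(L(G)):=\sup_{e\in\mathcal E}\deg_{L(G)}(e)$. Assume $\Delta(L(G))<\infty$. Then $$\|\Delta_1\|\le\Delta(L(G))+2 ,$$ the same bound holds for $\widetilde\Delta_1=\Delta_1$, and $\Delta_1$ (initially defined on $\mathcal C^1_c$) extends uniquely to a bounded self-adjoint operator on $\ell^2(\mathcal E,m_1)$. In particular, for any $d$-regular graph $G$ with $d\ge2$ (so that the maximal degree is $\Delta(G)=d$), $$\|\widetilde\Delta_1\|=\|\Delta_1\|\le2\Delta(G)=2d .$$
   Context: Graphs are simple and undirected with countable vertex set. Locally finite means every vertex has finitely many neighbors. The line graph $L(G)$ has the edges of $G$ as vertices, two distinct edges being adjacent iff they share an endpoint. The graph is regarded as a $1$-dimensional complex. A $1$-cochain is a function $f$ on oriented edges with $f([y,x])=-f([x,y])$; $\mathcal C^1_c$ is the space of finitely supported $1$-cochains; $\ell^2(\mathcal E,m_1)$ is the space of $1$-cochains with $\|f\|^2=\sum_{\{x,y\}\in\mathcal E}m_1(x,y)|f([x,y])|^2<\infty$. The coboundary is $(d^1u)([x,y])=u(y)-u(x)$, its formal adjoint is $(\delta^1f)(x)=\frac1{m_0(x)}\sum_{y\sim x}m_1(x,y)f([y,x])$, and $\Delta_1=d^1\delta^1$ (no up-term, since the complex is truncated at dimension $1$ even if $G$ contains triangles). The normalized block is $\widetilde\Delta_1=M_1^{1/2}\Delta_1M_1^{-1/2}$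 with $M_1$ multiplication by $m_1$; in the unweighted case $\widetilde\Delta_1=\Delta_1$. *)

theory Defs
  imports "HOL-Analysis.Analysis"
begin

section \<open>Graphs\<close>

definition simple_graph :: "'v set \<Rightarrow> 'v set set \<Rightarrow> bool" where
  "simple_graph V E \<longleftrightarrow> (\<forall>e\<in>E. e \<subseteq> V \<and> card e = 2)"

definition neighbours :: "'v set set \<Rightarrow> 'v \<Rightarrow> 'v set" where
  "neighbours E x = {y. {x, y} \<in> E}"

definition locally_finite_graph :: "'v set \<Rightarrow> 'v set set \<Rightarrow> bool" where
  "locally_finite_graph V E \<longleftrightarrow> (\<forall>x\<in>V. finite (neighbours E x))"

text \<open>Degrees are extended naturals, since \<open>card\<close> of an infinite set is 0.\<close>

definition vdegree :: "'v set set \<Rightarrow> 'v \<Rightarrow> enat" where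
  "vdegree E x = (if finite (neighbours E x) then enat (card (neighbours E x)) else \<infinity>)"

definition max_degree :: "'v set \<Rightarrow> 'v set set \<Rightarrow> enat" where
  "max_degree V E = (SUP x\<in>V. vdegree E x)"

definition regular_graph :: "nat \<Rightarrow> 'v set \<Rightarrow> 'v set set \<Rightarrow> bool" where
  "regular_graph d V E \<longleftrightarrow> (\<forall>x\<in>V. vdegree E x = enat d)"

text \<open>The line graph has vertex set \<open>E\<close> and the following edge set.\<close>

definition line_graph_edges :: "'v set set \<Rightarrow> 'v set set set" where
  "line_graph_edges E = {{e, e'} | e e'. e \<in> E \<and> e' \<in> E \<and> e \<noteq> e' \<and> e \<inter> e' \<noteq> {}}"


section \<open>Cochains and \<open>\<ell>\<^sup>2\<close>\<close>

text \<open>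
  The oriented edge \<open>[x, y]\<close> is the pair \<open>(x, y)\<close> with \<open>{x, y} \<in> E\<close>. Cochains are extended by 0
  to all other pairs, so that equality of cochains is equality of functions.
\<close>

type_synonym 'v cochain = "'v \<times> 'v \<Rightarrow> complex"

definition cochains :: "'v set set \<Rightarrow> 'v cochain set" where
  "cochains E = {f. (\<forall>x y. {x, y} \<in> E \<longrightarrow> f (y, x) = - f (x, y)) \<and>
                    (\<forall>x y. {x, y} \<notin> E \<longrightarrow> f (x, y) = 0)}"

definition cochains_c :: "'v set set \<Rightarrow> 'v cochain set" where
  "cochains_c E = {f \<in> cochains E. finite {p. f p \<noteq> 0}}"

text \<open>
  A reference orientation, used to sum over unoriented edges. The summands below do not depend on
  it when \<open>f\<close> and \<open>g\<close> are cochains (see \<open>cochain_orient_norm\<close>, \<open>cochain_orient_inner\<close>).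
\<close>

definition orient :: "'v set \<Rightarrow> 'v \<times> 'v" where
  "orient e = (SOME p. e = {fst p, snd p})"

definition l2_norm :: "'v set set \<Rightarrow> ('v set \<Rightarrow> real) \<Rightarrow> 'v cochain \<Rightarrow> ennreal" where
  "l2_norm E m\<^sub>1 f =
     (if (\<lambda>e. m\<^sub>1 e * (cmod (f (orient e)))\<^sup>2) summable_on E
      then ennreal (sqrt (\<Sum>\<^sub>\<infinity>e\<in>E. m\<^sub>1 e * (cmod (f (orient e)))\<^sup>2)) else \<infinity>)"

definition ell2 :: "'v set set \<Rightarrow> ('v set \<Rightarrow> real) \<Rightarrow> 'v cochain set" where
  "ell2 E m\<^sub>1 = {f \<in> cochains E. l2_norm E m\<^sub>1 f < \<infinity>}"

definition l2_inner :: "'v set set \<Rightarrow> ('v set \<Rightarrow> real) \<Rightarrow> 'v cochain \<Rightarrow> 'v cochain \<Rightarrow> complex" where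
  "l2_inner E m\<^sub>1 f g =
     (\<Sum>\<^sub>\<infinity>e\<in>E. complex_of_real (m\<^sub>1 e) * f (orient e) * cnj (g (orient e)))"

lemma orient_cases:
  obtains "orient {x, y} = (x, y)" | "orient {x, y} = (y, x)"
proof -
  have "{x, y} = {fst (orient {x, y}), snd (orient {x, y})}"
    unfolding orient_def by (rule someI[of _ "(x, y)"]) simp
  then have "orient {x, y} = (x, y) \<or> orient {x, y} = (y, x)"
    by (metis doubleton_eq_iff prod.collapse)
  then show thesis using that by blast
qed

lemma cochain_orient_norm:
  assumes "f \<in> cochains E" "{x, y} \<in> E"
  shows "cmod (f (orient {x, y})) = cmod (f (x, y))"
  using assms by (cases rule: orient_cases[of x y]) (auto simp: cochains_def)

lemma cochain_orient_inner:
  assumes "f \<in> cochains E" "g \<in> cochains E" "{x, y} \<in> E"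
  shows "f (orient {x, y}) * cnj (g (orient {x, y})) = f (x, y) * cnj (g (x, y))"
  using assms by (cases rule: orient_cases[of x y]) (auto simp: cochains_def)


section \<open>Operators\<close>

definition op_norm ::
  "'v set set \<Rightarrow> ('v set \<Rightarrow> real) \<Rightarrow> 'v cochain set \<Rightarrow> ('v cochain \<Rightarrow> 'v cochain) \<Rightarrow> ennreal" where
  "op_norm E m\<^sub>1 D T = (SUP f\<in>{f \<in> D. l2_norm E m\<^sub>1 f \<le> 1}. l2_norm E m\<^sub>1 (T f))"

text \<open>
  Everywhere defined bounded operators; the extensional function space makes equality of operators
  equality of functions.
\<close>

definition bounded_operators ::
  "'v set set \<Rightarrow> ('v set \<Rightarrow> real) \<Rightarrow> ('v cochain \<Rightarrow> 'v cochain) set" where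
  "bounded_operators E m\<^sub>1 =
     {T \<in> ell2 E m\<^sub>1 \<rightarrow>\<^sub>E ell2 E m\<^sub>1.
        (\<forall>f\<in>ell2 E m\<^sub>1. \<forall>g\<in>ell2 E m\<^sub>1. \<forall>a b.
           T (\<lambda>p. a * f p + b * g p) = (\<lambda>p. a * T f p + b * T g p)) \<and>
        op_norm E m\<^sub>1 (ell2 E m\<^sub>1) T < \<infinity>}"

definition bounded_self_adjoint ::
  "'v set set \<Rightarrow> ('v set \<Rightarrow> real) \<Rightarrow> ('v cochain \<Rightarrow> 'v cochain) \<Rightarrow> bool" where
  "bounded_self_adjoint E m\<^sub>1 T \<longleftrightarrow> T \<in> bounded_operators E m\<^sub>1 \<and>
     (\<forall>f\<in>ell2 E m\<^sub>1. \<forall>g\<in>ell2 E m\<^sub>1. l2_inner E m\<^sub>1 (T f) g = l2_inner E m\<^sub>1 f (T g))"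

definition coboundary :: "'v set set \<Rightarrow> ('v \<Rightarrow> complex) \<Rightarrow> 'v cochain" where
  "coboundary E u = (\<lambda>(x, y). if {x, y} \<in> E then u y - u x else 0)"

definition codifferential ::
  "'v set set \<Rightarrow> ('v \<Rightarrow> real) \<Rightarrow> ('v set \<Rightarrow> real) \<Rightarrow> 'v cochain \<Rightarrow> 'v \<Rightarrow> complex" where
  "codifferential E m\<^sub>0 m\<^sub>1 f x =
     1 / complex_of_real (m\<^sub>0 x) * (\<Sum>y\<in>neighbours E x. complex_of_real (m\<^sub>1 {x, y}) * f (y, x))"

definition Laplacian1 ::
  "'v set set \<Rightarrow> ('v \<Rightarrow> real) \<Rightarrow> ('v set \<Rightarrow> real) \<Rightarrow> 'v cochain \<Rightarrow> 'v cochain" where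
  "Laplacian1 E m\<^sub>0 m\<^sub>1 f = coboundary E (codifferential E m\<^sub>0 m\<^sub>1 f)"

definition multiplication :: "('v set \<Rightarrow> real) \<Rightarrow> 'v cochain \<Rightarrow> 'v cochain" where
  "multiplication s f = (\<lambda>(x, y). complex_of_real (s {x, y}) * f (x, y))"

definition normalized_Laplacian1 ::
  "'v set set \<Rightarrow> ('v \<Rightarrow> real) \<Rightarrow> ('v set \<Rightarrow> real) \<Rightarrow> 'v cochain \<Rightarrow> 'v cochain" where
  "normalized_Laplacian1 E m\<^sub>0 m\<^sub>1 f =
     multiplication (\<lambda>e. sqrt (m\<^sub>1 e))
       (Laplacian1 E m\<^sub>0 m\<^sub>1 (multiplication (\<lambda>e. 1 / sqrt (m\<^sub>1 e)) f))"

end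

theory Submission
  imports Defs
begin

text \<open>
  After an orientation of the edges has been chosen, a cochain is just a family of complex numbers
  indexed by \<open>E\<close>, and \<open>\<Delta>\<^sub>1\<close> becomes the matrix \<open>B\<^sup>T B\<close>, where \<open>B\<close> is the vertex-edge incidence
  matrix with entries \<open>1\<close> at the head and \<open>- 1\<close> at the tail of an edge
  (\<open>Laplacian1_eq_kernel_sum\<close>). This matrix is real and symmetric. Its diagonal entries are \<open>2\<close>, the
  entry at two distinct edges sharing an endpoint is \<open>1\<close> or \<open>- 1\<close>, and all other entries vanish. So
  up to signs it is \<open>2\<close> plus the adjacency matrix of the line graph, and the absolute values in
  the row of \<open>e\<close> add up to \<open>2\<close> plus the degree of \<open>e\<close> in the line graph
  (\<open>edge_kernel_row_sum\<close>).

  For a symmetric matrix a bound on the absolute row sums also bounds the absolute column sums, and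
  the Schur test turns the two into the same bound for the operator norm on \<open>\<ell>\<^sup>2\<close>
  (\<open>schur_test\<close>). The absolute convergence behind that test also allows the exchange of summations
  that gives self-adjointness (\<open>apply_kernel_self_adjoint\<close>).

  Each row being finite, the formula for \<open>\<Delta>\<^sub>1\<close> makes sense on all of \<open>\<ell>\<^sup>2\<close> and yields the bounded
  extension directly, without passing to limits. It has the same norm as \<open>\<Delta>\<^sub>1\<close> on finitely
  supported cochains because its values on finitely many edges depend on finitely many edges
  (\<open>op_norm_Laplacian1_ell2\<close>). It is unique because finitely supported cochains are dense
  (\<open>bounded_operators_eqI\<close>).

  In a \<open>d\<close>-regular graph an edge meets \<open>d - 1\<close> further edges at each end, so the line graph
  has degree at most \<open>2 d - 2\<close> and the general bound becomes \<open>2 d\<close>.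
\<close>

section \<open>Symmetric kernels of finite range on square-summable families\<close>

text \<open>
  Only the columns in \<open>N e\<close> enter row \<open>e\<close> of the operator. They are a parameter, and not the
  support of the row, so that they can be chosen combinatorially.
\<close>

locale schur_kernel =
  fixes E :: "'e set" and N :: "'e \<Rightarrow> 'e set" and K :: "'e \<Rightarrow> 'e \<Rightarrow> real" and C :: real
  assumes finite_range: "\<And>e. e \<in> E \<Longrightarrow> finite (N e)"
    and range_subset: "\<And>e. e \<in> E \<Longrightarrow> N e \<subseteq> E"
    and range_sym: "\<And>e e'. e \<in> E \<Longrightarrow> e' \<in> E \<Longrightarrow> e' \<in> N e \<longleftrightarrow> e \<in> N e'"
    and kernel_sym: "\<And>e e'. K e e' = K e' e"
    and row_sum: "\<And>e. e \<in> E \<Longrightarrow> (\<Sum>e'\<in>N e. \<bar>K e e'\<bar>) \<le> C"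
    and bound_nonneg: "0 \<le> C"
begin

definition apply_kernel :: "('e \<Rightarrow> complex) \<Rightarrow> 'e \<Rightarrow> complex" where
  "apply_kernel f e = (\<Sum>e'\<in>N e. complex_of_real (K e e') * f e')"

text \<open>Cauchy--Schwarz after splitting \<open>\<bar>K e e'\<bar>\<close> evenly into two square roots.\<close>

lemma apply_kernel_pointwise:
  assumes "e \<in> E"
  shows "(cmod (apply_kernel f e))\<^sup>2 \<le> C * (\<Sum>e'\<in>N e. \<bar>K e e'\<bar> * (cmod (f e'))\<^sup>2)"
proof -
  have "cmod (apply_kernel f e) \<le> (\<Sum>e'\<in>N e. \<bar>K e e'\<bar> * cmod (f e'))"
    unfolding apply_kernel_def by (rule order.trans[OF norm_sum]) (simp add: norm_mult)
  also have "\<dots> = (\<Sum>e'\<in>N e. sqrt \<bar>K e e'\<bar> * (sqrt \<bar>K e e'\<bar> * cmod (f e')))"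
    by (simp flip: mult.assoc)
  finally have "(cmod (apply_kernel f e))\<^sup>2
      \<le> (\<Sum>e'\<in>N e. sqrt \<bar>K e e'\<bar> * (sqrt \<bar>K e e'\<bar> * cmod (f e')))\<^sup>2"
    by (simp add: power_mono)
  also have "\<dots> \<le> (\<Sum>e'\<in>N e. (sqrt \<bar>K e e'\<bar>)\<^sup>2) * (\<Sum>e'\<in>N e. (sqrt \<bar>K e e'\<bar> * cmod (f e'))\<^sup>2)"
    by (rule Cauchy_Schwarz_ineq_sum)
  also have "\<dots> = (\<Sum>e'\<in>N e. \<bar>K e e'\<bar>) * (\<Sum>e'\<in>N e. \<bar>K e e'\<bar> * (cmod (f e'))\<^sup>2)"
    by (simp add: power_mult_distrib)
  also have "\<dots> \<le> C * (\<Sum>e'\<in>N e. \<bar>K e e'\<bar> * (cmod (f e'))\<^sup>2)"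
    using row_sum[OF assms] by (intro mult_right_mono sum_nonneg) auto
  finally show ?thesis .
qed

text \<open>
  The columns of the matrix satisfy the same bound as its rows because the matrix is symmetric, so
  the double sum is estimated by carrying out the sum over \<open>e\<close> first.
\<close>

lemma column_sum_bound:
  assumes "finite F" "F \<subseteq> E" and b: "\<And>e. 0 \<le> b e"
  shows "(\<Sum>e\<in>F. \<Sum>e'\<in>N e. \<bar>K e e'\<bar> * b e') \<le> C * (\<Sum>e\<in>(\<Union>e\<in>F. N e). b e)"
proof -
  let ?U = "\<Union>e\<in>F. N e"
  have fin: "finite ?U" and sub: "?U \<subseteq> E"
    using assms finite_range range_subset by blast+
  have "(\<Sum>e\<in>F. \<Sum>e'\<in>N e. \<bar>K e e'\<bar> * b e')
      = (\<Sum>e\<in>F. \<Sum>e'\<in>{e'\<in>?U. e' \<in> N e}. \<bar>K e e'\<bar> * b e')"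
    by (intro sum.cong) auto
  also have "\<dots> = (\<Sum>e'\<in>?U. \<Sum>e\<in>{e\<in>F. e' \<in> N e}. \<bar>K e e'\<bar> * b e')"
    by (rule sum.swap_restrict[OF assms(1) fin])
  also have "\<dots> = (\<Sum>e'\<in>?U. (\<Sum>e\<in>{e\<in>F. e' \<in> N e}. \<bar>K e' e\<bar>) * b e')"
    by (simp add: sum_distrib_right kernel_sym)
  also have "\<dots> \<le> (\<Sum>e'\<in>?U. C * b e')"
  proof (intro sum_mono mult_right_mono b)
    fix e' assume "e' \<in> ?U"
    then have e': "e' \<in> E" using sub by blast
    have "{e\<in>F. e' \<in> N e} \<subseteq> N e'"
      using assms(2) range_sym[OF _ e'] by blast
    then have "(\<Sum>e\<in>{e\<in>F. e' \<in> N e}. \<bar>K e' e\<bar>) \<le> (\<Sum>e\<in>N e'. \<bar>K e' e\<bar>)"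
      by (intro sum_mono2 finite_range[OF e']) auto
    also have "\<dots> \<le> C" by (rule row_sum[OF e'])
    finally show "(\<Sum>e\<in>{e\<in>F. e' \<in> N e}. \<bar>K e' e\<bar>) \<le> C" .
  qed
  finally show ?thesis by (simp add: sum_distrib_left)
qed

lemma schur_test:
  assumes "finite F" "F \<subseteq> E"
  shows "(\<Sum>e\<in>F. (cmod (apply_kernel f e))\<^sup>2) \<le> C\<^sup>2 * (\<Sum>e\<in>(\<Union>e\<in>F. N e). (cmod (f e))\<^sup>2)"
proof -
  have "(\<Sum>e\<in>F. (cmod (apply_kernel f e))\<^sup>2)
      \<le> (\<Sum>e\<in>F. C * (\<Sum>e'\<in>N e. \<bar>K e e'\<bar> * (cmod (f e'))\<^sup>2))"
    using assms by (intro sum_mono apply_kernel_pointwise) blast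
  also have "\<dots> = C * (\<Sum>e\<in>F. \<Sum>e'\<in>N e. \<bar>K e e'\<bar> * (cmod (f e'))\<^sup>2)"
    by (simp add: sum_distrib_left)
  also have "\<dots> \<le> C * (C * (\<Sum>e\<in>(\<Union>e\<in>F. N e). (cmod (f e))\<^sup>2))"
    by (intro mult_left_mono column_sum_bound assms bound_nonneg) simp
  finally show ?thesis by (simp add: power2_eq_square mult.assoc)
qed

text \<open>
  Both sides are iterated sums of \<open>K e e' f(e') cnj (g e)\<close> over the pairs with \<open>e' \<in> N e\<close>. By
  \<open>2 \<bar>f\<bar> \<bar>g\<bar> \<le> \<bar>f\<bar>\<^sup>2 + \<bar>g\<bar>\<^sup>2\<close> and the row and column bounds this family is absolutely
  summable, so the order of summation may be exchanged; \<open>K\<close> is real, hence unchanged by \<open>cnj\<close>.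
\<close>

lemma apply_kernel_self_adjoint:
  assumes f: "(\<lambda>e. (cmod (f e))\<^sup>2) summable_on E" and g: "(\<lambda>e. (cmod (g e))\<^sup>2) summable_on E"
  shows "(\<Sum>\<^sub>\<infinity>e\<in>E. apply_kernel f e * cnj (g e)) = (\<Sum>\<^sub>\<infinity>e\<in>E. f e * cnj (apply_kernel g e))"
proof -
  let ?h = "\<lambda>(e, e'). complex_of_real (K e e') * f e' * cnj (g e)"
  let ?A = "\<Sum>\<^sub>\<infinity>e\<in>E. (cmod (f e))\<^sup>2" and ?B = "\<Sum>\<^sub>\<infinity>e\<in>E. (cmod (g e))\<^sup>2"
  have fin_bound: "(\<Sum>p\<in>P. cmod (?h p)) \<le> (C * ?A + C * ?B) / 2"
    if P: "finite P" "P \<subseteq> Sigma E N" for P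
  proof -
    let ?F = "fst ` P"
    have F: "finite ?F" "?F \<subseteq> E" using P by auto
    have PS: "P \<subseteq> Sigma ?F N" using P by force
    have finS: "finite (Sigma ?F N)" using F finite_range by blast
    have finU: "finite (\<Union>e\<in>?F. N e)" "(\<Union>e\<in>?F. N e) \<subseteq> E"
      using F finite_range range_subset by blast+
    have am_gm: "cmod (?h (e, e')) \<le> (\<bar>K e e'\<bar> * (cmod (f e'))\<^sup>2 + \<bar>K e e'\<bar> * (cmod (g e))\<^sup>2) / 2"
      for e e'
    proof -
      have "2 * (cmod (f e') * cmod (g e)) \<le> (cmod (f e'))\<^sup>2 + (cmod (g e))\<^sup>2"
        using sum_squares_bound[of "cmod (f e')" "cmod (g e)"] by (simp add: mult.assoc)
      from mult_left_mono[OF this, of "\<bar>K e e'\<bar>"] show ?thesis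
        by (simp add: norm_mult algebra_simps)
    qed
    have "(\<Sum>p\<in>P. cmod (?h p)) \<le> (\<Sum>p\<in>Sigma ?F N. cmod (?h p))"
      by (rule sum_mono2[OF finS PS]) simp
    also have "\<dots> = (\<Sum>e\<in>?F. \<Sum>e'\<in>N e. cmod (?h (e, e')))"
      using F finite_range by (subst sum.Sigma) (auto simp: case_prod_unfold)
    also have "\<dots> \<le> (\<Sum>e\<in>?F. \<Sum>e'\<in>N e. (\<bar>K e e'\<bar> * (cmod (f e'))\<^sup>2 + \<bar>K e e'\<bar> * (cmod (g e))\<^sup>2) / 2)"
      by (intro sum_mono am_gm)
    also have "\<dots> = ((\<Sum>e\<in>?F. \<Sum>e'\<in>N e. \<bar>K e e'\<bar> * (cmod (f e'))\<^sup>2)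
        + (\<Sum>e\<in>?F. (\<Sum>e'\<in>N e. \<bar>K e e'\<bar>) * (cmod (g e))\<^sup>2)) / 2"
      by (simp add: sum.distrib sum_distrib_right flip: sum_divide_distrib)
    also have "\<dots> \<le> (C * (\<Sum>e\<in>(\<Union>e\<in>?F. N e). (cmod (f e))\<^sup>2) + (\<Sum>e\<in>?F. C * (cmod (g e))\<^sup>2)) / 2"
      using F row_sum
      by (intro divide_right_mono add_mono column_sum_bound sum_mono mult_right_mono) auto
    also have "\<dots> \<le> (C * ?A + C * ?B) / 2"
      unfolding sum_distrib_left[symmetric]
      using F finU f g bound_nonneg
      by (intro divide_right_mono add_mono mult_left_mono finite_sum_le_infsum) auto
    finally show ?thesis .
  qed
  have "(\<lambda>p. norm (?h p)) summable_on Sigma E N"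
    by (rule nonneg_bounded_partial_sums_imp_summable_on[where C = "(C * ?A + C * ?B) / 2"])
       (use fin_bound in \<open>auto simp del: le_divide_eq_numeral1 intro!: eventually_finite_subsets_at_top_weakI\<close>)
  then have sm: "?h summable_on Sigma E N" by (rule abs_summable_summable)
  have "prod.swap p \<in> Sigma E N" if "p \<in> Sigma E N" for p
    using that range_subset[of "fst p"] range_sym[of "fst p" "snd p"] by (cases p) auto
  then have swap: "bij_betw prod.swap (Sigma E N) (Sigma E N)"
    by (intro bij_betwI[where g = prod.swap]) auto
  let ?h' = "\<lambda>(e', e). complex_of_real (K e e') * f e' * cnj (g e)"
  have h': "?h' = (\<lambda>p. ?h (prod.swap p))" by auto
  have sm': "?h' summable_on Sigma E N"
    unfolding h' using sm summable_on_reindex_bij_betw[OF swap, of ?h] by blast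
  have "(\<Sum>\<^sub>\<infinity>e\<in>E. apply_kernel f e * cnj (g e)) = (\<Sum>\<^sub>\<infinity>e\<in>E. \<Sum>\<^sub>\<infinity>e'\<in>N e. ?h (e, e'))"
    by (intro infsum_cong) (simp add: apply_kernel_def sum_distrib_right finite_range)
  also have "\<dots> = infsum ?h (Sigma E N)"
    using infsum_Sigma'_banach[OF sm] by simp
  also have "\<dots> = infsum ?h' (Sigma E N)"
    unfolding h' by (rule infsum_reindex_bij_betw[OF swap, symmetric])
  also have "\<dots> = (\<Sum>\<^sub>\<infinity>e'\<in>E. \<Sum>\<^sub>\<infinity>e\<in>N e'. ?h' (e', e))"
    using infsum_Sigma'_banach[OF sm'] by simp
  also have "\<dots> = (\<Sum>\<^sub>\<infinity>e\<in>E. f e * cnj (apply_kernel g e))"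
    by (intro infsum_cong)
       (simp add: apply_kernel_def sum_distrib_left finite_range kernel_sym mult_ac)
  finally show ?thesis .
qed

end

section \<open>The norm of unweighted cochains\<close>

lemma l2_norm_unweighted:
  assumes "\<forall>e\<in>E. m\<^sub>1 e = 1"
  shows "l2_norm E m\<^sub>1 f =
    (if (\<lambda>e. (cmod (f (orient e)))\<^sup>2) summable_on E
     then ennreal (sqrt (\<Sum>\<^sub>\<infinity>e\<in>E. (cmod (f (orient e)))\<^sup>2)) else \<infinity>)"
proof -
  have "(\<lambda>e. m\<^sub>1 e * (cmod (f (orient e)))\<^sup>2) summable_on E
      \<longleftrightarrow> (\<lambda>e. (cmod (f (orient e)))\<^sup>2) summable_on E"
    using assms by (intro summable_on_cong) simp
  moreover have "(\<Sum>\<^sub>\<infinity>e\<in>E. m\<^sub>1 e * (cmod (f (orient e)))\<^sup>2) = (\<Sum>\<^sub>\<infinity>e\<in>E. (cmod (f (orient e)))\<^sup>2)"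
    using assms by (intro infsum_cong) simp
  ultimately show ?thesis unfolding l2_norm_def by simp
qed

text \<open>
  The summands are nonnegative, so finite partial sums determine both convergence and the norm. This
  reduces norm estimates to finite sets of edges, where no convergence question arises.
\<close>

lemma l2_norm_le_iff:
  assumes m: "\<forall>e\<in>E. m\<^sub>1 e = 1" and c: "0 \<le> c"
  shows "l2_norm E m\<^sub>1 f \<le> ennreal c \<longleftrightarrow>
    (\<forall>F. finite F \<and> F \<subseteq> E \<longrightarrow> (\<Sum>e\<in>F. (cmod (f (orient e)))\<^sup>2) \<le> c\<^sup>2)" (is "?L \<longleftrightarrow> ?R")
proof
  let ?q = "\<lambda>e. (cmod (f (orient e)))\<^sup>2"
  assume L: ?L
  then have sm: "?q summable_on E"
    by (auto simp: l2_norm_unweighted[OF m] top_unique split: if_splits)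
  with L c have "sqrt (infsum ?q E) \<le> c" by (simp add: l2_norm_unweighted[OF m])
  then have "infsum ?q E \<le> c\<^sup>2" by (rule sqrt_le_D)
  moreover have "sum ?q F \<le> infsum ?q E" if "finite F" "F \<subseteq> E" for F
    using that sm by (intro finite_sum_le_infsum) auto
  ultimately show ?R by force
next
  let ?q = "\<lambda>e. (cmod (f (orient e)))\<^sup>2"
  assume R: ?R
  then have sm: "?q summable_on E"
    by (intro nonneg_bounded_partial_sums_imp_summable_on[where C = "c\<^sup>2"])
       (auto intro: eventually_finite_subsets_at_top_weakI)
  have "infsum ?q E \<le> c\<^sup>2"
    using R by (intro infsum_le_finite_sums[OF sm]) auto
  then have "sqrt (infsum ?q E) \<le> c"
    using c by (simp add: real_le_lsqrt)
  then show ?L using sm by (simp add: l2_norm_unweighted[OF m] ennreal_leI)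
qed

lemma ell2_iff_summable:
  assumes "\<forall>e\<in>E. m\<^sub>1 e = 1"
  shows "f \<in> ell2 E m\<^sub>1 \<longleftrightarrow> f \<in> cochains E \<and> (\<lambda>e. (cmod (f (orient e)))\<^sup>2) summable_on E"
  by (auto simp: ell2_def l2_norm_unweighted[OF assms])

lemma ennreal_finite_obtains:
  assumes "(x :: ennreal) < \<infinity>"
  obtains c where "0 \<le> c" "x = ennreal c"
  using assms by (cases x rule: ennreal_cases) auto

lemma cmod_le_of_l2_norm_le:
  assumes "\<forall>e\<in>E. m\<^sub>1 e = 1" "0 \<le> c" "l2_norm E m\<^sub>1 f \<le> ennreal c" "e \<in> E"
  shows "cmod (f (orient e)) \<le> c"
proof -
  have "(\<Sum>e\<in>{e}. (cmod (f (orient e)))\<^sup>2) \<le> c\<^sup>2"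
    using assms(3,4) unfolding l2_norm_le_iff[OF assms(1,2)] by blast
  then show ?thesis using assms(2) by (simp add: power2_le_iff_abs_le)
qed

lemma cochainsI:
  assumes "\<And>x y. {x, y} \<in> E \<Longrightarrow> f (y, x) = - f (x, y)" "\<And>x y. {x, y} \<notin> E \<Longrightarrow> f (x, y) = 0"
  shows "f \<in> cochains E"
  using assms unfolding cochains_def by blast

lemma cochain_antisym: "f \<in> cochains E \<Longrightarrow> {x, y} \<in> E \<Longrightarrow> f (y, x) = - f (x, y)"
  and cochain_off_edges: "f \<in> cochains E \<Longrightarrow> {x, y} \<notin> E \<Longrightarrow> f (x, y) = 0"
  unfolding cochains_def by blast+

text \<open>The linear combinations are written in the shape used in \<^const>\<open>bounded_operators\<close>.\<close>

lemma cochains_linear_combination: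
  assumes "f \<in> cochains E" "g \<in> cochains E"
  shows "(\<lambda>p. a * f p + b * g p) \<in> cochains E"
proof (rule cochainsI)
  fix x y assume "{x, y} \<in> E"
  from cochain_antisym[OF assms(1) this] cochain_antisym[OF assms(2) this]
  show "a * f (y, x) + b * g (y, x) = - (a * f (x, y) + b * g (x, y))" by simp
qed (simp add: cochain_off_edges[OF assms(1)] cochain_off_edges[OF assms(2)])

lemma ell2_scale:
  assumes m: "\<forall>e\<in>E. m\<^sub>1 e = 1" and f: "f \<in> ell2 E m\<^sub>1"
  shows "(\<lambda>p. a * f p) \<in> ell2 E m\<^sub>1"
proof -
  have "(\<lambda>p. a * f p) \<in> cochains E"
    using f cochains_linear_combination[of f E f a 0] by (simp add: ell2_def)
  moreover have "(\<lambda>e. (cmod (a * f (orient e)))\<^sup>2) summable_on E"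
    using f summable_on_cmult_right[of "\<lambda>e. (cmod (f (orient e)))\<^sup>2" E "(cmod a)\<^sup>2"]
    by (simp add: ell2_iff_summable[OF m] norm_mult power_mult_distrib)
  ultimately show ?thesis by (simp add: ell2_iff_summable[OF m])
qed

lemma cochain_eqI:
  assumes f: "f \<in> cochains E" and g: "g \<in> cochains E"
    and eq: "\<And>e. e \<in> E \<Longrightarrow> f (orient e) = g (orient e)"
  shows "f = g"
proof
  fix p :: "'a \<times> 'a"
  obtain x y where p: "p = (x, y)" by force
  show "f p = g p"
  proof (cases "{x, y} \<in> E")
    case True
    show ?thesis
      using eq[OF True] p cochain_antisym[OF f True] cochain_antisym[OF g True]
      by (cases rule: orient_cases[of x y]) auto
  next
    case False
    then show ?thesis using f g p by (simp add: cochain_off_edges)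
  qed
qed

section \<open>Truncation and uniqueness of bounded extensions\<close>

definition truncate :: "'v set set \<Rightarrow> 'v cochain \<Rightarrow> 'v cochain" where
  "truncate F f = (\<lambda>(x, y). if {x, y} \<in> F then f (x, y) else 0)"

lemma simple_graph_edgeE:
  assumes "simple_graph V E" "e \<in> E"
  obtains a b where "a \<noteq> b" "e = {a, b}" "orient e = (a, b)" "a \<in> V" "b \<in> V"
proof -
  have "card e = 2" and V: "e \<subseteq> V" using assms by (auto simp: simple_graph_def)
  then obtain x y where xy: "e = {x, y}" "x \<noteq> y" by (auto simp: card_2_iff)
  show thesis
  proof (cases rule: orient_cases[of x y])
    case 1
    then show ?thesis using that[of x y] xy V by simp
  next
    case 2
    then show ?thesis using that[of y x] xy V by (simp add: insert_commute)
  qed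
qed

lemma truncate_orient:
  assumes "simple_graph V E" "e \<in> E"
  shows "truncate F f (orient e) = (if e \<in> F then f (orient e) else 0)"
proof -
  obtain a b where "e = {a, b}" "orient e = (a, b)" using simple_graph_edgeE[OF assms] by metis
  then show ?thesis by (simp add: truncate_def)
qed

lemma truncate_in_cochains_c:
  assumes G: "simple_graph V E" and f: "f \<in> cochains E" and F: "finite F" "F \<subseteq> E"
  shows "truncate F f \<in> cochains_c E"
proof -
  have "truncate F f \<in> cochains E"
  proof (rule cochainsI)
    fix x y assume "{x, y} \<in> E"
    from cochain_antisym[OF f this] show "truncate F f (y, x) = - truncate F f (x, y)"
      by (simp add: truncate_def insert_commute)
  qed (use F in \<open>auto simp: truncate_def\<close>)
  moreover have "{p. truncate F f p \<noteq> 0} \<subseteq> (\<Union>F) \<times> (\<Union>F)"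
    by (auto simp: truncate_def split: if_splits)
  moreover have "finite (\<Union>F)"
  proof (rule finite_Union[OF F(1)])
    fix e assume "e \<in> F"
    then have "card e = 2" using G F by (auto simp: simple_graph_def)
    then show "finite e" by (intro card_ge_0_finite) simp
  qed
  ultimately show ?thesis
    unfolding cochains_c_def by (blast intro: finite_subset finite_cartesian_product)
qed

lemma cochains_c_subset_ell2:
  assumes G: "simple_graph V E" and m: "\<forall>e\<in>E. m\<^sub>1 e = 1"
  shows "cochains_c E \<subseteq> ell2 E m\<^sub>1"
proof
  fix f assume f: "f \<in> cochains_c E"
  let ?S = "{e\<in>E. f (orient e) \<noteq> 0}"
  have "inj_on orient E"
  proof (rule inj_onI)
    fix e e' assume *: "e \<in> E" "e' \<in> E" "orient e = orient e'"
    have "e = {fst (orient e), snd (orient e)}" if "e \<in> E" for e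
      using simple_graph_edgeE[OF G that] by (metis fst_conv snd_conv)
    from this[OF *(1)] this[OF *(2)] show "e = e'" by (simp only: *(3))
  qed
  moreover have "finite {p. f p \<noteq> 0}" using f by (simp add: cochains_c_def)
  ultimately have "finite (orient -` {p. f p \<noteq> 0} \<inter> E)"
    by (intro finite_vimage_IntI)
  then have "finite ?S" by (rule rev_finite_subset) auto
  then have "(\<lambda>e. (cmod (f (orient e)))\<^sup>2) summable_on ?S" by simp
  then have "(\<lambda>e. (cmod (f (orient e)))\<^sup>2) summable_on E"
    by (rule summable_on_cong_neutral[THEN iffD1, rotated -1]) auto
  then show "f \<in> ell2 E m\<^sub>1" using f by (simp add: ell2_iff_summable[OF m] cochains_c_def)
qed

lemma truncation_dense:
  assumes G: "simple_graph V E" and m: "\<forall>e\<in>E. m\<^sub>1 e = 1" and f: "f \<in> ell2 E m\<^sub>1" and \<epsilon>: "0 < \<epsilon>"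
  obtains F where "finite F" "F \<subseteq> E" "(\<lambda>p. f p - truncate F f p) \<in> ell2 E m\<^sub>1"
    "l2_norm E m\<^sub>1 (\<lambda>p. f p - truncate F f p) \<le> ennreal \<epsilon>"
proof -
  let ?q = "\<lambda>e. (cmod (f (orient e)))\<^sup>2"
  have fc: "f \<in> cochains E" and sm: "?q summable_on E"
    using f by (auto simp: ell2_iff_summable[OF m])
  have "\<exists>F. finite F \<and> F \<subseteq> E \<and> infsum ?q E - \<epsilon>\<^sup>2 < sum ?q F"
  proof (rule ccontr)
    assume "\<not> ?thesis"
    then have "infsum ?q E \<le> infsum ?q E - \<epsilon>\<^sup>2"
      by (intro infsum_le_finite_sums[OF sm]) (auto simp: not_less)
    then show False using \<epsilon> by simp
  qed
  then obtain F where F: "finite F" "F \<subseteq> E" and tail: "infsum ?q E - \<epsilon>\<^sup>2 < sum ?q F" by blast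
  let ?h = "\<lambda>p. f p - truncate F f p"
  have le: "l2_norm E m\<^sub>1 ?h \<le> ennreal \<epsilon>"
    unfolding l2_norm_le_iff[OF m less_imp_le[OF \<epsilon>]]
  proof (intro allI impI)
    fix H assume H: "finite H \<and> H \<subseteq> E"
    \<comment> \<open>The edges of \<open>F\<close> contribute nothing, so the sum is part of the tail outside \<open>F\<close>.\<close>
    have "(\<Sum>e\<in>H. (cmod (?h (orient e)))\<^sup>2) = (\<Sum>e\<in>H. if e \<in> F then 0 else ?q e)"
      using H by (intro sum.cong) (auto simp: truncate_orient[OF G])
    also have "\<dots> = sum ?q (H - F)"
      using H by (simp add: sum.If_cases Diff_eq)
    also have "\<dots> = sum ?q (F \<union> (H - F)) - sum ?q F"
      using H F by (subst sum.union_disjoint) auto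
    also have "\<dots> \<le> infsum ?q E - sum ?q F"
      using H F sm by (intro diff_right_mono finite_sum_le_infsum) auto
    finally show "(\<Sum>e\<in>H. (cmod (?h (orient e)))\<^sup>2) \<le> \<epsilon>\<^sup>2" using tail by simp
  qed
  have "?h \<in> cochains E"
    using cochains_linear_combination[of f E "truncate F f" 1 "-1"] fc
      truncate_in_cochains_c[OF G fc F] by (simp add: cochains_c_def)
  then have "?h \<in> ell2 E m\<^sub>1"
    using le by (auto simp: ell2_def intro: le_less_trans)
  then show thesis using that F le by blast
qed

lemma bounded_operator_linear:
  assumes "T \<in> bounded_operators E m\<^sub>1" "f \<in> ell2 E m\<^sub>1" "g \<in> ell2 E m\<^sub>1"
  shows "T (\<lambda>p. a * f p + b * g p) = (\<lambda>p. a * T f p + b * T g p)"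
  using assms unfolding bounded_operators_def by simp

text \<open>
  By homogeneity the bound on the unit ball scales to all of \<open>\<ell>\<^sup>2\<close>. A bound on single values is
  enough to separate operators, since a cochain is determined by one value on each edge.
\<close>

lemma bounded_operator_pointwise:
  assumes m: "\<forall>e\<in>E. m\<^sub>1 e = 1" and T: "T \<in> bounded_operators E m\<^sub>1"
  obtains M where "0 \<le> M"
    "\<And>h \<epsilon> e. h \<in> ell2 E m\<^sub>1 \<Longrightarrow> 0 < \<epsilon> \<Longrightarrow> l2_norm E m\<^sub>1 h \<le> ennreal \<epsilon> \<Longrightarrow> e \<in> E
       \<Longrightarrow> cmod (T h (orient e)) \<le> M * \<epsilon>"
proof -
  have "op_norm E m\<^sub>1 (ell2 E m\<^sub>1) T < \<infinity>" using T by (simp add: bounded_operators_def)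
  then obtain M where M: "0 \<le> M" "op_norm E m\<^sub>1 (ell2 E m\<^sub>1) T = ennreal M"
    by (rule ennreal_finite_obtains)
  have "cmod (T h (orient e)) \<le> M * \<epsilon>"
    if h: "h \<in> ell2 E m\<^sub>1" and \<epsilon>: "0 < \<epsilon>" and le: "l2_norm E m\<^sub>1 h \<le> ennreal \<epsilon>" and e: "e \<in> E"
    for h \<epsilon> e
  proof -
    let ?h = "\<lambda>p. complex_of_real (1 / \<epsilon>) * h p"
    have h': "?h \<in> ell2 E m\<^sub>1" by (rule ell2_scale[OF m h])
    have "l2_norm E m\<^sub>1 ?h \<le> ennreal 1"
      unfolding l2_norm_le_iff[OF m zero_le_one]
    proof (intro allI impI)
      fix F assume F: "finite F \<and> F \<subseteq> E"
      have "(\<Sum>e\<in>F. (cmod (?h (orient e)))\<^sup>2) = (\<Sum>e\<in>F. (cmod (h (orient e)))\<^sup>2) / \<epsilon>\<^sup>2"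
        using \<epsilon> by (simp add: norm_mult norm_divide power_divide sum_divide_distrib)
      also have "\<dots> \<le> 1"
        using le F \<epsilon> unfolding l2_norm_le_iff[OF m less_imp_le[OF \<epsilon>]] by (simp add: divide_le_eq_1)
      finally show "(\<Sum>e\<in>F. (cmod (?h (orient e)))\<^sup>2) \<le> 1\<^sup>2" by simp
    qed
    then have "l2_norm E m\<^sub>1 (T ?h) \<le> ennreal M"
      unfolding M(2)[symmetric] op_norm_def using h' by (intro SUP_upper) simp
    then have *: "cmod (T ?h (orient e)) \<le> M" by (rule cmod_le_of_l2_norm_le[OF m M(1) _ e])
    have "T ?h = (\<lambda>p. complex_of_real (1 / \<epsilon>) * T h p)"
      using bounded_operator_linear[OF T h h, of "complex_of_real (1 / \<epsilon>)" 0] by simp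
    with * show ?thesis using \<epsilon> by (simp add: norm_mult norm_divide divide_le_eq)
  qed
  with M(1) that show thesis by blast
qed

text \<open>
  By the density of finitely supported cochains: on \<open>f\<close> minus a truncation both operators are small, and on
  the truncation they agree.
\<close>

lemma bounded_operators_eqI:
  assumes G: "simple_graph V E" and m: "\<forall>e\<in>E. m\<^sub>1 e = 1"
    and S: "S \<in> bounded_operators E m\<^sub>1" and T: "T \<in> bounded_operators E m\<^sub>1"
    and eq: "\<And>f. f \<in> cochains_c E \<Longrightarrow> S f = T f"
  shows "S = T"
proof
  fix f
  show "S f = T f"
  proof (cases "f \<in> ell2 E m\<^sub>1")
    case False
    then show ?thesis using S T by (auto simp: bounded_operators_def PiE_def extensional_def)
  next
    case f: True
    obtain M where M: "0 \<le> M" "\<And>h \<epsilon> e. h \<in> ell2 E m\<^sub>1 \<Longrightarrow> 0 < \<epsilon> \<Longrightarrow>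
        l2_norm E m\<^sub>1 h \<le> ennreal \<epsilon> \<Longrightarrow> e \<in> E \<Longrightarrow> cmod (S h (orient e)) \<le> M * \<epsilon>"
      using bounded_operator_pointwise[OF m S] by blast
    obtain L where L: "0 \<le> L" "\<And>h \<epsilon> e. h \<in> ell2 E m\<^sub>1 \<Longrightarrow> 0 < \<epsilon> \<Longrightarrow>
        l2_norm E m\<^sub>1 h \<le> ennreal \<epsilon> \<Longrightarrow> e \<in> E \<Longrightarrow> cmod (T h (orient e)) \<le> L * \<epsilon>"
      using bounded_operator_pointwise[OF m T] by blast
    have "S f (orient e) = T f (orient e)" if e: "e \<in> E" for e
    proof -
      have small: "cmod (S f (orient e) - T f (orient e)) \<le> (M + L + 1) * \<epsilon>" if \<epsilon>: "0 < \<epsilon>" for \<epsilon>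
      proof -
        obtain F where F: "finite F" "F \<subseteq> E" and h: "(\<lambda>p. f p - truncate F f p) \<in> ell2 E m\<^sub>1"
          "l2_norm E m\<^sub>1 (\<lambda>p. f p - truncate F f p) \<le> ennreal \<epsilon>"
          by (rule truncation_dense[OF G m f \<epsilon>])
        let ?h = "\<lambda>p. f p - truncate F f p"
        have tc: "truncate F f \<in> cochains_c E"
          using f F by (intro truncate_in_cochains_c[OF G]) (simp_all add: ell2_def)
        then have t: "truncate F f \<in> ell2 E m\<^sub>1" using cochains_c_subset_ell2[OF G m] by blast
        have split: "R f p = R (truncate F f) p + R ?h p" if R: "R \<in> bounded_operators E m\<^sub>1" for R p
          using bounded_operator_linear[OF R t h(1), of 1 1] by simp
        have "S f (orient e) - T f (orient e) = S ?h (orient e) - T ?h (orient e)"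
          using split[OF S] split[OF T] eq[OF tc] by simp
        also have "cmod \<dots> \<le> M * \<epsilon> + L * \<epsilon>"
          using M(2)[OF h(1) \<epsilon> h(2) e] L(2)[OF h(1) \<epsilon> h(2) e]
          by (intro order.trans[OF norm_triangle_ineq4]) simp
        finally show ?thesis using \<epsilon> by (simp add: algebra_simps)
      qed
      \<comment> \<open>Adding \<open>1\<close> keeps the constant positive when both norms are \<open>0\<close>, so that it can be
        divided out.\<close>
      have pos: "0 < M + L + 1" using M(1) L(1) by simp
      have "cmod (S f (orient e) - T f (orient e)) \<le> 0 + \<delta>" if "0 < \<delta>" for \<delta>
        using small[of "\<delta> / (M + L + 1)"] pos that by simp
      then have "cmod (S f (orient e) - T f (orient e)) \<le> 0" by (rule field_le_epsilon)
      then show ?thesis by simp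
    qed
    moreover have "S f \<in> cochains E" "T f \<in> cochains E"
      using S T f by (auto simp: bounded_operators_def ell2_def)
    ultimately show ?thesis by (intro cochain_eqI)
  qed
qed

section \<open>The Laplacian as a kernel on edges\<close>

definition star :: "'v set set \<Rightarrow> 'v \<Rightarrow> 'v set set" where
  "star E x = {e \<in> E. x \<in> e}"

text \<open>The edge \<open>e\<close> itself is included, because it carries the diagonal entry of the kernel.\<close>

definition touching :: "'v set set \<Rightarrow> 'v set \<Rightarrow> 'v set set" where
  "touching E e = {e' \<in> E. e \<inter> e' \<noteq> {}}"

definition incidence :: "'v set \<Rightarrow> 'v \<Rightarrow> real" where
  "incidence e x = (if x = snd (orient e) then 1 else if x = fst (orient e) then - 1 else 0)"

text \<open>The matrix \<open>B\<^sup>T B\<close> of the oriented incidence matrix \<open>B\<close>, restricted to common endpoints.\<close>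

definition edge_kernel :: "'v set \<Rightarrow> 'v set \<Rightarrow> real" where
  "edge_kernel e e' = (\<Sum>x\<in>e \<inter> e'. incidence e x * incidence e' x)"

lemma abs_edge_kernel_le: "\<bar>edge_kernel e e'\<bar> \<le> real (card (e \<inter> e'))"
proof -
  have "\<bar>edge_kernel e e'\<bar> \<le> (\<Sum>x\<in>e \<inter> e'. \<bar>incidence e x * incidence e' x\<bar>)"
    unfolding edge_kernel_def by (rule sum_abs)
  also have "\<dots> \<le> (\<Sum>x\<in>e \<inter> e'. 1)"
    by (intro sum_mono) (simp add: incidence_def)
  finally show ?thesis by simp
qed

lemma star_eq_image_neighbours:
  assumes "simple_graph V E"
  shows "star E x = (\<lambda>y. {x, y}) ` neighbours E x"
proof
  show "(\<lambda>y. {x, y}) ` neighbours E x \<subseteq> star E x" by (auto simp: star_def neighbours_def)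
  show "star E x \<subseteq> (\<lambda>y. {x, y}) ` neighbours E x"
  proof
    fix e assume "e \<in> star E x"
    then have e: "e \<in> E" "x \<in> e" by (auto simp: star_def)
    obtain a b where "e = {a, b}" using simple_graph_edgeE[OF assms e(1)] by metis
    then show "e \<in> (\<lambda>y. {x, y}) ` neighbours E x"
      using e by (auto simp: neighbours_def insert_commute)
  qed
qed

lemma inj_on_pair_with: "inj_on (\<lambda>y. {x, y}) A"
  by (auto simp: inj_on_def doubleton_eq_iff)

lemma card_star:
  assumes "simple_graph V E"
  shows "card (star E x) = card (neighbours E x)"
  unfolding star_eq_image_neighbours[OF assms] by (rule card_image[OF inj_on_pair_with])

lemma finite_star:
  assumes "simple_graph V E" "locally_finite_graph V E" "x \<in> V"
  shows "finite (star E x)"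
  using assms by (simp add: star_eq_image_neighbours[OF assms(1)] locally_finite_graph_def)

lemma finite_touching:
  assumes G: "simple_graph V E" and lf: "locally_finite_graph V E" and e: "e \<in> E"
  shows "finite (touching E e)"
proof -
  obtain a b where ab: "e = {a, b}" "a \<in> V" "b \<in> V" using simple_graph_edgeE[OF G e] by metis
  have "touching E e \<subseteq> star E a \<union> star E b" using ab by (auto simp: touching_def star_def)
  then show ?thesis using ab finite_star[OF G lf] by (meson finite_UnI finite_subset)
qed

text \<open>
  The value \<open>f (y, x)\<close> is that of \<open>f\<close> on \<open>{x, y}\<close> oriented towards \<open>x\<close>; the incidence number
  at \<open>x\<close> records whether the reference orientation agrees.
\<close>

lemma codifferential_eq_star_sum:
  assumes G: "simple_graph V E" and f: "f \<in> cochains E" and x: "m\<^sub>0 x = 1"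
    and m: "\<forall>e\<in>E. m\<^sub>1 e = 1"
  shows "codifferential E m\<^sub>0 m\<^sub>1 f x = (\<Sum>e\<in>star E x. complex_of_real (incidence e x) * f (orient e))"
proof -
  have "f (y, x) = complex_of_real (incidence {x, y} x) * f (orient {x, y})"
    if "y \<in> neighbours E x" for y
  proof -
    have e: "{x, y} \<in> E" using that by (simp add: neighbours_def)
    then have "x \<noteq> y" using G by (auto simp: simple_graph_def)
    moreover have "f (y, x) = - f (x, y)" by (rule cochain_antisym[OF f e])
    ultimately show ?thesis
      by (cases rule: orient_cases[of x y]) (auto simp: incidence_def)
  qed
  then show ?thesis
    using m x
    by (simp add: codifferential_def star_eq_image_neighbours[OF G]
        sum.reindex[OF inj_on_pair_with] neighbours_def)
qed

text \<open>
  The value on an oriented edge is the codifferential at its head minus that at its tail, which is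
  the sum over its endpoints weighted with their incidence numbers. Exchanging this sum with the one
  over the star of each endpoint collects, for every edge \<open>e'\<close>, the endpoints common to \<open>e\<close> and \<open>e'\<close>.
\<close>

lemma Laplacian1_eq_kernel_sum:
  assumes G: "simple_graph V E" and lf: "locally_finite_graph V E"
    and m0: "\<forall>x\<in>V. m\<^sub>0 x = 1" and m1: "\<forall>e\<in>E. m\<^sub>1 e = 1"
    and f: "f \<in> cochains E" and e: "e \<in> E"
  shows "Laplacian1 E m\<^sub>0 m\<^sub>1 f (orient e)
    = (\<Sum>e'\<in>touching E e. complex_of_real (edge_kernel e e') * f (orient e'))"
proof -
  obtain a b where ab: "a \<noteq> b" "e = {a, b}" "orient e = (a, b)" "a \<in> V" "b \<in> V"
    by (rule simple_graph_edgeE[OF G e])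
  let ?s = "\<lambda>x. \<Sum>e'\<in>star E x. complex_of_real (incidence e' x) * f (orient e')"
  have "Laplacian1 E m\<^sub>0 m\<^sub>1 f (orient e) = ?s b - ?s a"
    using ab e m0 by (simp add: Laplacian1_def coboundary_def codifferential_eq_star_sum[OF G f _ m1])
  also have "\<dots> = (\<Sum>x\<in>e. complex_of_real (incidence e x) * ?s x)"
    using ab by (simp add: incidence_def)
  also have "\<dots> = (\<Sum>x\<in>e. \<Sum>e'\<in>{e'\<in>touching E e. x \<in> e'}.
      complex_of_real (incidence e x * incidence e' x) * f (orient e'))"
    by (intro sum.cong refl)
       (auto simp: sum_distrib_left mult.assoc star_def touching_def intro!: sum.cong)
  also have "\<dots> = (\<Sum>e'\<in>touching E e. \<Sum>x\<in>{x\<in>e. x \<in> e'}.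
      complex_of_real (incidence e x * incidence e' x) * f (orient e'))"
    using ab by (intro sum.swap_restrict finite_touching[OF G lf e]) simp
  also have "\<dots> = (\<Sum>e'\<in>touching E e. complex_of_real (edge_kernel e e') * f (orient e'))"
    by (simp add: edge_kernel_def sum_distrib_right Collect_conj_eq Int_commute)
  finally show ?thesis .
qed

lemma Laplacian1_in_cochains: "Laplacian1 E m\<^sub>0 m\<^sub>1 f \<in> cochains E"
  by (rule cochainsI) (simp_all add: Laplacian1_def coboundary_def insert_commute)

lemma Laplacian1_linear:
  "Laplacian1 E m\<^sub>0 m\<^sub>1 (\<lambda>p. a * f p + b * g p)
    = (\<lambda>p. a * Laplacian1 E m\<^sub>0 m\<^sub>1 f p + b * Laplacian1 E m\<^sub>0 m\<^sub>1 g p)"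
proof -
  have "codifferential E m\<^sub>0 m\<^sub>1 (\<lambda>p. a * f p + b * g p) x
      = a * codifferential E m\<^sub>0 m\<^sub>1 f x + b * codifferential E m\<^sub>0 m\<^sub>1 g x" for x
    by (simp add: codifferential_def algebra_simps sum.distrib sum_distrib_left)
  then show ?thesis by (auto simp: Laplacian1_def coboundary_def algebra_simps)
qed

lemma normalized_Laplacian1_unweighted:
  assumes m: "\<forall>e\<in>E. m\<^sub>1 e = 1" and f: "f \<in> cochains E"
  shows "normalized_Laplacian1 E m\<^sub>0 m\<^sub>1 f = Laplacian1 E m\<^sub>0 m\<^sub>1 f"
proof -
  have mult: "multiplication s g = g" if "\<forall>e\<in>E. s e = 1" "g \<in> cochains E" for s g
    using that by (auto simp: multiplication_def fun_eq_iff cochain_off_edges split: prod.split)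
  have "multiplication (\<lambda>e. 1 / sqrt (m\<^sub>1 e)) f = f" using m f by (intro mult) auto
  then show ?thesis
    unfolding normalized_Laplacian1_def using m by (simp add: mult Laplacian1_in_cochains)
qed

section \<open>Degrees in the line graph\<close>

lemma neighbours_line_graph:
  assumes "e \<in> E"
  shows "neighbours (line_graph_edges E) e = touching E e - {e}"
  using assms by (auto simp: neighbours_def line_graph_edges_def touching_def doubleton_eq_iff)

lemma card_edges_Int_le_1:
  assumes "simple_graph V E" "e \<in> E" "e' \<in> E" "e \<noteq> e'"
  shows "card (e \<inter> e') \<le> 1"
proof (rule ccontr)
  assume "\<not> ?thesis"
  moreover have "card e = 2" "card e' = 2" using assms by (auto simp: simple_graph_def)
  moreover from this have "finite e" "finite e'" by (auto intro: card_ge_0_finite)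
  ultimately have "e \<inter> e' = e" "e \<inter> e' = e'" by (intro card_seteq; simp)+
  then show False using assms by simp
qed

text \<open>
  The entry at \<open>e'\<close> is at most the number of common endpoints, which is \<open>2\<close> for \<open>e' = e\<close> and at
  most \<open>1\<close> for each line-graph neighbour of \<open>e\<close>.
\<close>

lemma edge_kernel_row_sum:
  assumes G: "simple_graph V E" and lf: "locally_finite_graph V E" and e: "e \<in> E"
    and n: "max_degree E (line_graph_edges E) \<le> enat n"
  shows "(\<Sum>e'\<in>touching E e. \<bar>edge_kernel e e'\<bar>) \<le> real n + 2"
proof -
  have card_e: "card e = 2" using G e by (auto simp: simple_graph_def)
  then have "e \<noteq> {}" by auto
  then have self: "e \<in> touching E e" using e by (auto simp: touching_def)
  have fin: "finite (touching E e)" by (rule finite_touching[OF G lf e])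
  have "vdegree (line_graph_edges E) e \<le> enat n"
    using n e unfolding max_degree_def by (meson SUP_upper order.trans)
  then have deg: "card (touching E e - {e}) \<le> n"
    using fin by (simp add: vdegree_def neighbours_line_graph[OF e])
  have "(\<Sum>e'\<in>touching E e. \<bar>edge_kernel e e'\<bar>) \<le> (\<Sum>e'\<in>touching E e. real (card (e \<inter> e')))"
    by (intro sum_mono abs_edge_kernel_le)
  also have "\<dots> = real (card (e \<inter> e)) + (\<Sum>e'\<in>touching E e - {e}. real (card (e \<inter> e')))"
    by (rule sum.remove[OF fin self])
  also have "\<dots> \<le> 2 + (\<Sum>e'\<in>touching E e - {e}. 1)"
    using card_edges_Int_le_1[OF G e] card_e
    by (intro add_mono sum_mono) (auto simp: touching_def)
  also have "\<dots> \<le> real n + 2" using deg by simp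
  finally show ?thesis .
qed

lemma edge_schur_kernel:
  assumes "simple_graph V E" "locally_finite_graph V E"
    and "max_degree E (line_graph_edges E) \<le> enat n"
  shows "schur_kernel E (touching E) edge_kernel (real n + 2)"
proof
  fix e e' :: "'a set"
  show "edge_kernel e e' = edge_kernel e' e"
    by (simp add: edge_kernel_def Int_commute mult.commute)
qed (use assms finite_touching edge_kernel_row_sum in \<open>auto simp: touching_def\<close>)

text \<open>Each of the two endpoints of an edge lies on \<open>d - 1\<close> other edges.\<close>

lemma max_degree_line_graph_regular:
  assumes G: "simple_graph V E" and reg: "regular_graph d V E"
  shows "max_degree E (line_graph_edges E) \<le> enat (2 * d - 2)"
  unfolding max_degree_def
proof (rule SUP_least)
  fix e assume e: "e \<in> E"
  obtain a b where ab: "a \<noteq> b" "e = {a, b}" "a \<in> V" "b \<in> V"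
    by (rule simple_graph_edgeE[OF G e])
  have star: "finite (star E x - {e}) \<and> card (star E x - {e}) = d - 1" if "x \<in> V" "x \<in> e" for x
  proof -
    have "finite (neighbours E x) \<and> card (neighbours E x) = d"
      using reg that by (auto simp: regular_graph_def vdegree_def split: if_splits)
    then have "card (star E x) = d" and "finite (star E x)"
      using card_star[OF G, of x] star_eq_image_neighbours[OF G, of x] finite_imageI by metis+
    moreover have "e \<in> star E x" using e that by (simp add: star_def)
    ultimately show ?thesis by simp
  qed
  have un: "touching E e - {e} = (star E a - {e}) \<union> (star E b - {e})"
    using ab by (auto simp: touching_def star_def)
  have "finite (touching E e - {e})" using un star ab by simp
  moreover have "card (touching E e - {e}) \<le> 2 * d - 2"
    unfolding un using card_Un_le[of "star E a - {e}" "star E b - {e}"] star[of a] star[of b] ab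
    by simp
  ultimately show "vdegree (line_graph_edges E) e \<le> enat (2 * d - 2)"
    by (simp add: vdegree_def neighbours_line_graph[OF e])
qed

section \<open>Boundedness of the Laplacian\<close>

lemma l2_norm_Laplacian1_le:
  assumes G: "simple_graph V E" and lf: "locally_finite_graph V E"
    and m0: "\<forall>x\<in>V. m\<^sub>0 x = 1" and m1: "\<forall>e\<in>E. m\<^sub>1 e = 1"
    and n: "max_degree E (line_graph_edges E) \<le> enat n"
    and f: "f \<in> cochains E" and c: "0 \<le> c" "l2_norm E m\<^sub>1 f \<le> ennreal c"
  shows "l2_norm E m\<^sub>1 (Laplacian1 E m\<^sub>0 m\<^sub>1 f) \<le> ennreal ((real n + 2) * c)"
proof -
  interpret schur_kernel E "touching E" edge_kernel "real n + 2"
    by (rule edge_schur_kernel[OF G lf n])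
  have "0 \<le> (real n + 2) * c" using c by simp
  then show ?thesis
    unfolding l2_norm_le_iff[OF m1 \<open>0 \<le> (real n + 2) * c\<close>]
  proof (intro allI impI)
    fix F assume F: "finite F \<and> F \<subseteq> E"
    have "(\<Sum>e\<in>F. (cmod (Laplacian1 E m\<^sub>0 m\<^sub>1 f (orient e)))\<^sup>2)
        = (\<Sum>e\<in>F. (cmod (apply_kernel (\<lambda>e. f (orient e)) e))\<^sup>2)"
      using F by (intro sum.cong refl)
        (auto simp: apply_kernel_def Laplacian1_eq_kernel_sum[OF G lf m0 m1 f])
    also have "\<dots> \<le> (real n + 2)\<^sup>2 * (\<Sum>e\<in>(\<Union>e\<in>F. touching E e). (cmod (f (orient e)))\<^sup>2)"
      using F by (intro schur_test) auto
    also have "\<dots> \<le> (real n + 2)\<^sup>2 * c\<^sup>2"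
    proof (intro mult_left_mono)
      have "finite (\<Union>e\<in>F. touching E e)" "(\<Union>e\<in>F. touching E e) \<subseteq> E"
        using F finite_range range_subset by blast+
      then show "(\<Sum>e\<in>(\<Union>e\<in>F. touching E e). (cmod (f (orient e)))\<^sup>2) \<le> c\<^sup>2"
        using c unfolding l2_norm_le_iff[OF m1 c(1)] by blast
    qed simp
    finally show "(\<Sum>e\<in>F. (cmod (Laplacian1 E m\<^sub>0 m\<^sub>1 f (orient e)))\<^sup>2) \<le> ((real n + 2) * c)\<^sup>2"
      by (simp add: power_mult_distrib)
  qed
qed

lemma op_norm_Laplacian1_le:
  assumes "simple_graph V E" "locally_finite_graph V E"
    and "\<forall>x\<in>V. m\<^sub>0 x = 1" "\<forall>e\<in>E. m\<^sub>1 e = 1"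
    and "max_degree E (line_graph_edges E) \<le> enat n" and D: "D \<subseteq> cochains E"
  shows "op_norm E m\<^sub>1 D (Laplacian1 E m\<^sub>0 m\<^sub>1) \<le> ennreal (real n + 2)"
  unfolding op_norm_def
proof (rule SUP_least)
  fix f assume "f \<in> {f \<in> D. l2_norm E m\<^sub>1 f \<le> 1}"
  then show "l2_norm E m\<^sub>1 (Laplacian1 E m\<^sub>0 m\<^sub>1 f) \<le> ennreal (real n + 2)"
    using l2_norm_Laplacian1_le[OF assms(1-5), of f 1] D by auto
qed

lemma op_norm_cong:
  assumes "\<And>f. f \<in> D \<Longrightarrow> S f = T f"
  shows "op_norm E m\<^sub>1 D S = op_norm E m\<^sub>1 D T"
  using assms unfolding op_norm_def by (intro SUP_cong) auto

lemma Laplacian1_truncate: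
  assumes G: "simple_graph V E" and lf: "locally_finite_graph V E"
    and m0: "\<forall>x\<in>V. m\<^sub>0 x = 1" and m1: "\<forall>e\<in>E. m\<^sub>1 e = 1"
    and f: "f \<in> cochains E" and e: "e \<in> E" and F: "finite F" "F \<subseteq> E" "touching E e \<subseteq> F"
  shows "Laplacian1 E m\<^sub>0 m\<^sub>1 (truncate F f) (orient e) = Laplacian1 E m\<^sub>0 m\<^sub>1 f (orient e)"
proof -
  have t: "truncate F f \<in> cochains E"
    using truncate_in_cochains_c[OF G f F(1,2)] by (simp add: cochains_c_def)
  show ?thesis
    unfolding Laplacian1_eq_kernel_sum[OF G lf m0 m1 t e] Laplacian1_eq_kernel_sum[OF G lf m0 m1 f e]
    using F by (intro sum.cong refl) (auto simp: truncate_orient[OF G] subset_iff)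
qed

text \<open>
  Since the kernel has finite range, on any finite set of edges the image of \<open>f\<close> coincides with the
  image of a sufficiently large truncation of \<open>f\<close>, and truncating does not increase the norm.
\<close>

lemma op_norm_Laplacian1_ell2:
  assumes G: "simple_graph V E" and lf: "locally_finite_graph V E"
    and m0: "\<forall>x\<in>V. m\<^sub>0 x = 1" and m1: "\<forall>e\<in>E. m\<^sub>1 e = 1"
    and fin: "op_norm E m\<^sub>1 (cochains_c E) (Laplacian1 E m\<^sub>0 m\<^sub>1) < \<infinity>"
  shows "op_norm E m\<^sub>1 (ell2 E m\<^sub>1) (Laplacian1 E m\<^sub>0 m\<^sub>1)
    = op_norm E m\<^sub>1 (cochains_c E) (Laplacian1 E m\<^sub>0 m\<^sub>1)"
proof (rule antisym)
  show "op_norm E m\<^sub>1 (cochains_c E) (Laplacian1 E m\<^sub>0 m\<^sub>1)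
      \<le> op_norm E m\<^sub>1 (ell2 E m\<^sub>1) (Laplacian1 E m\<^sub>0 m\<^sub>1)"
    unfolding op_norm_def using cochains_c_subset_ell2[OF G m1] by (intro SUP_subset_mono) auto
  obtain M where M: "0 \<le> M" "op_norm E m\<^sub>1 (cochains_c E) (Laplacian1 E m\<^sub>0 m\<^sub>1) = ennreal M"
    using ennreal_finite_obtains[OF fin] .
  show "op_norm E m\<^sub>1 (ell2 E m\<^sub>1) (Laplacian1 E m\<^sub>0 m\<^sub>1)
      \<le> op_norm E m\<^sub>1 (cochains_c E) (Laplacian1 E m\<^sub>0 m\<^sub>1)"
    unfolding M(2) unfolding op_norm_def
  proof (rule SUP_least)
    fix f assume "f \<in> {f \<in> ell2 E m\<^sub>1. l2_norm E m\<^sub>1 f \<le> 1}"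
    then have f: "f \<in> cochains E" and f1: "l2_norm E m\<^sub>1 f \<le> ennreal 1" by (auto simp: ell2_def)
    show "l2_norm E m\<^sub>1 (Laplacian1 E m\<^sub>0 m\<^sub>1 f) \<le> ennreal M"
      unfolding l2_norm_le_iff[OF m1 M(1)]
    proof (intro allI impI)
      fix F assume F: "finite F \<and> F \<subseteq> E"
      let ?H = "\<Union>e\<in>F. touching E e"
      let ?t = "truncate ?H f"
      have H: "finite ?H" "?H \<subseteq> E"
        using F finite_touching[OF G lf] by (auto simp: touching_def)
      have "l2_norm E m\<^sub>1 ?t \<le> ennreal 1"
        unfolding l2_norm_le_iff[OF m1 zero_le_one]
      proof (intro allI impI)
        fix F' assume F': "finite F' \<and> F' \<subseteq> E"
        have "(\<Sum>e\<in>F'. (cmod (?t (orient e)))\<^sup>2) \<le> (\<Sum>e\<in>F'. (cmod (f (orient e)))\<^sup>2)"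
          using F' by (intro sum_mono) (auto simp: truncate_orient[OF G])
        also have "\<dots> \<le> 1\<^sup>2" using f1 F' unfolding l2_norm_le_iff[OF m1 zero_le_one] by blast
        finally show "(\<Sum>e\<in>F'. (cmod (?t (orient e)))\<^sup>2) \<le> 1\<^sup>2" .
      qed
      then have "l2_norm E m\<^sub>1 (Laplacian1 E m\<^sub>0 m\<^sub>1 ?t) \<le> ennreal M"
        unfolding M(2)[symmetric] op_norm_def
        using truncate_in_cochains_c[OF G f H] by (intro SUP_upper) simp
      then have "(\<Sum>e\<in>F. (cmod (Laplacian1 E m\<^sub>0 m\<^sub>1 ?t (orient e)))\<^sup>2) \<le> M\<^sup>2"
        using F unfolding l2_norm_le_iff[OF m1 M(1)] by blast
      moreover have "Laplacian1 E m\<^sub>0 m\<^sub>1 ?t (orient e) = Laplacian1 E m\<^sub>0 m\<^sub>1 f (orient e)"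
        if "e \<in> F" for e
        using that F by (intro Laplacian1_truncate[OF G lf m0 m1 f _ H]) auto
      ultimately show "(\<Sum>e\<in>F. (cmod (Laplacian1 E m\<^sub>0 m\<^sub>1 f (orient e)))\<^sup>2) \<le> M\<^sup>2" by simp
    qed
  qed
qed

lemma l2_inner_unweighted:
  assumes "\<forall>e\<in>E. m\<^sub>1 e = 1"
  shows "l2_inner E m\<^sub>1 f g = (\<Sum>\<^sub>\<infinity>e\<in>E. f (orient e) * cnj (g (orient e)))"
  using assms unfolding l2_inner_def by (intro infsum_cong) simp

lemma Laplacian1_self_adjoint:
  assumes G: "simple_graph V E" and lf: "locally_finite_graph V E"
    and m0: "\<forall>x\<in>V. m\<^sub>0 x = 1" and m1: "\<forall>e\<in>E. m\<^sub>1 e = 1"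
    and n: "max_degree E (line_graph_edges E) \<le> enat n"
    and f: "f \<in> ell2 E m\<^sub>1" and g: "g \<in> ell2 E m\<^sub>1"
  shows "l2_inner E m\<^sub>1 (Laplacian1 E m\<^sub>0 m\<^sub>1 f) g = l2_inner E m\<^sub>1 f (Laplacian1 E m\<^sub>0 m\<^sub>1 g)"
proof -
  interpret schur_kernel E "touching E" edge_kernel "real n + 2"
    by (rule edge_schur_kernel[OF G lf n])
  have eq: "Laplacian1 E m\<^sub>0 m\<^sub>1 h (orient e) = apply_kernel (\<lambda>e. h (orient e)) e"
    if "h \<in> ell2 E m\<^sub>1" "e \<in> E" for h e
    using that by (simp add: ell2_def apply_kernel_def Laplacian1_eq_kernel_sum[OF G lf m0 m1])
  have "l2_inner E m\<^sub>1 (Laplacian1 E m\<^sub>0 m\<^sub>1 f) g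
      = (\<Sum>\<^sub>\<infinity>e\<in>E. apply_kernel (\<lambda>e. f (orient e)) e * cnj (g (orient e)))"
    unfolding l2_inner_unweighted[OF m1] by (intro infsum_cong) (simp add: eq f)
  also have "\<dots> = (\<Sum>\<^sub>\<infinity>e\<in>E. f (orient e) * cnj (apply_kernel (\<lambda>e. g (orient e)) e))"
    using f g by (intro apply_kernel_self_adjoint) (simp_all add: ell2_iff_summable[OF m1])
  also have "\<dots> = l2_inner E m\<^sub>1 f (Laplacian1 E m\<^sub>0 m\<^sub>1 g)"
    unfolding l2_inner_unweighted[OF m1] by (intro infsum_cong) (simp add: eq g)
  finally show ?thesis .
qed

lemma restrict_Laplacian1_bounded_self_adjoint:
  assumes G: "simple_graph V E" and lf: "locally_finite_graph V E"
    and m0: "\<forall>x\<in>V. m\<^sub>0 x = 1" and m1: "\<forall>e\<in>E. m\<^sub>1 e = 1"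
    and n: "max_degree E (line_graph_edges E) \<le> enat n"
  shows "bounded_self_adjoint E m\<^sub>1 (restrict (Laplacian1 E m\<^sub>0 m\<^sub>1) (ell2 E m\<^sub>1))"
proof -
  let ?L = "Laplacian1 E m\<^sub>0 m\<^sub>1" and ?H = "ell2 E m\<^sub>1"
  have sub: "?H \<subseteq> cochains E" by (auto simp: ell2_def)
  have maps: "?L f \<in> ?H" if f: "f \<in> ?H" for f
  proof -
    have "l2_norm E m\<^sub>1 f < \<infinity>" using f by (simp add: ell2_def)
    then obtain c where c: "0 \<le> c" "l2_norm E m\<^sub>1 f = ennreal c"
      by (rule ennreal_finite_obtains)
    have "l2_norm E m\<^sub>1 (?L f) \<le> ennreal ((real n + 2) * c)"
      using f sub c by (intro l2_norm_Laplacian1_le[OF G lf m0 m1 n]) auto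
    then have "l2_norm E m\<^sub>1 (?L f) < \<infinity>" using ennreal_less_top le_less_trans by fastforce
    then show ?thesis by (simp add: ell2_def Laplacian1_in_cochains)
  qed
  \<comment> \<open>The restricted operator is \<open>undefined\<close> outside \<open>\<ell>\<^sup>2\<close>, so its linearity requires that linear
    combinations stay inside.\<close>
  have lin: "(\<lambda>p. a * f p + b * g p) \<in> ?H" if f: "f \<in> ?H" and g: "g \<in> ?H" for f g a b
  proof -
    have "(\<lambda>e. 2 * (cmod (a * f (orient e)))\<^sup>2 + 2 * (cmod (b * g (orient e)))\<^sup>2) summable_on E"
      using ell2_scale[OF m1 f, of a] ell2_scale[OF m1 g, of b]
      by (intro summable_on_add summable_on_cmult_right) (simp_all add: ell2_iff_summable[OF m1])
    moreover have "(cmod (u + v))\<^sup>2 \<le> 2 * (cmod u)\<^sup>2 + 2 * (cmod v)\<^sup>2" for u v :: complex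
    proof -
      have "(cmod (u + v))\<^sup>2 \<le> (cmod u + cmod v)\<^sup>2" by (intro power_mono norm_triangle_ineq) simp
      also have "\<dots> \<le> 2 * (cmod u)\<^sup>2 + 2 * (cmod v)\<^sup>2"
        using sum_squares_bound[of "cmod u" "cmod v"] by (simp add: power2_sum)
      finally show ?thesis .
    qed
    ultimately have "(\<lambda>e. (cmod (a * f (orient e) + b * g (orient e)))\<^sup>2) summable_on E"
      by (rule summable_on_comparison_test) auto
    then show ?thesis
      using f g cochains_linear_combination[of f E g a b] by (simp add: ell2_iff_summable[OF m1])
  qed
  have "op_norm E m\<^sub>1 ?H (restrict ?L ?H) = op_norm E m\<^sub>1 ?H ?L" by (rule op_norm_cong) simp
  also have "\<dots> \<le> ennreal (real n + 2)" by (rule op_norm_Laplacian1_le[OF G lf m0 m1 n sub])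
  also have "\<dots> < \<infinity>" by (simp add: less_top)
  finally have "restrict ?L ?H \<in> bounded_operators E m\<^sub>1"
    using maps lin by (simp add: bounded_operators_def Laplacian1_linear)
  then show ?thesis
    using Laplacian1_self_adjoint[OF G lf m0 m1 n] by (simp add: bounded_self_adjoint_def)
qed

theorem proposition7p4:
  fixes V :: "'v set" and E :: "'v set set"
    and m\<^sub>0 :: "'v \<Rightarrow> real" and m\<^sub>1 :: "'v set \<Rightarrow> real"
  assumes "simple_graph V E" and "countable V" and "locally_finite_graph V E"
    and "\<forall>x\<in>V. m\<^sub>0 x = 1" and "\<forall>e\<in>E. m\<^sub>1 e = 1"
  shows
    "(max_degree E (line_graph_edges E) < \<infinity> \<longrightarrow>
        op_norm E m\<^sub>1 (cochains_c E) (Laplacian1 E m\<^sub>0 m\<^sub>1)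
          \<le> ennreal_of_enat (max_degree E (line_graph_edges E)) + 2 \<and>
        op_norm E m\<^sub>1 (cochains_c E) (normalized_Laplacian1 E m\<^sub>0 m\<^sub>1)
          \<le> ennreal_of_enat (max_degree E (line_graph_edges E)) + 2 \<and>
        (\<forall>f\<in>cochains E. normalized_Laplacian1 E m\<^sub>0 m\<^sub>1 f = Laplacian1 E m\<^sub>0 m\<^sub>1 f) \<and>
        (\<exists>T. bounded_self_adjoint E m\<^sub>1 T \<and>
             (\<forall>f\<in>cochains_c E. T f = Laplacian1 E m\<^sub>0 m\<^sub>1 f) \<and>
             op_norm E m\<^sub>1 (ell2 E m\<^sub>1) T = op_norm E m\<^sub>1 (cochains_c E) (Laplacian1 E m\<^sub>0 m\<^sub>1) \<and>
             (\<forall>T'\<in>bounded_operators E m\<^sub>1.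
                (\<forall>f\<in>cochains_c E. T' f = Laplacian1 E m\<^sub>0 m\<^sub>1 f) \<longrightarrow> T' = T)))
     \<and> (\<forall>d\<ge>2. V \<noteq> {} \<and> regular_graph d V E \<longrightarrow>
          max_degree V E = enat d \<and>
          op_norm E m\<^sub>1 (cochains_c E) (normalized_Laplacian1 E m\<^sub>0 m\<^sub>1)
            = op_norm E m\<^sub>1 (cochains_c E) (Laplacian1 E m\<^sub>0 m\<^sub>1) \<and>
          op_norm E m\<^sub>1 (cochains_c E) (Laplacian1 E m\<^sub>0 m\<^sub>1)
            \<le> 2 * ennreal_of_enat (max_degree V E) \<and>
          2 * ennreal_of_enat (max_degree V E) = of_nat (2 * d))"
proof (intro conjI impI allI)
  note G = assms(1) and lf = assms(3) and m0 = assms(4) and m1 = assms(5)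
  let ?L = "Laplacian1 E m\<^sub>0 m\<^sub>1" and ?D = "max_degree E (line_graph_edges E)"
  have norm_eq: "op_norm E m\<^sub>1 (cochains_c E) (normalized_Laplacian1 E m\<^sub>0 m\<^sub>1)
      = op_norm E m\<^sub>1 (cochains_c E) ?L"
    by (rule op_norm_cong) (simp add: cochains_c_def normalized_Laplacian1_unweighted[OF m1])
  have cc: "cochains_c E \<subseteq> cochains E" by (auto simp: cochains_c_def)
  show "\<forall>f\<in>cochains E. normalized_Laplacian1 E m\<^sub>0 m\<^sub>1 f = ?L f"
    using normalized_Laplacian1_unweighted[OF m1] by blast
  {
    assume "?D < \<infinity>"
    then obtain n where n: "?D = enat n" by (cases ?D) auto
    then have n': "?D \<le> enat n" by simp
    have bound: "op_norm E m\<^sub>1 (cochains_c E) ?L \<le> ennreal (real n + 2)"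
      by (rule op_norm_Laplacian1_le[OF G lf m0 m1 n' cc])
    also have "ennreal (real n + 2) = ennreal_of_enat ?D + 2"
      by (simp add: n ennreal_plus ennreal_of_nat_eq_real_of_nat)
    finally show le: "op_norm E m\<^sub>1 (cochains_c E) ?L \<le> ennreal_of_enat ?D + 2" .
    then show "op_norm E m\<^sub>1 (cochains_c E) (normalized_Laplacian1 E m\<^sub>0 m\<^sub>1) \<le> ennreal_of_enat ?D + 2"
      unfolding norm_eq .
    let ?T = "restrict ?L (ell2 E m\<^sub>1)"
    have sa: "bounded_self_adjoint E m\<^sub>1 ?T"
      by (rule restrict_Laplacian1_bounded_self_adjoint[OF G lf m0 m1 n'])
    have ext: "?T f = ?L f" if "f \<in> cochains_c E" for f
      using that cochains_c_subset_ell2[OF G m1] by auto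
    have "op_norm E m\<^sub>1 (ell2 E m\<^sub>1) ?T = op_norm E m\<^sub>1 (ell2 E m\<^sub>1) ?L"
      by (rule op_norm_cong) simp
    also have "\<dots> = op_norm E m\<^sub>1 (cochains_c E) ?L"
      using bound by (intro op_norm_Laplacian1_ell2[OF G lf m0 m1]) (simp add: le_less_trans less_top)
    finally have same_norm: "op_norm E m\<^sub>1 (ell2 E m\<^sub>1) ?T = op_norm E m\<^sub>1 (cochains_c E) ?L" .
    have "T' = ?T" if "T' \<in> bounded_operators E m\<^sub>1" "\<forall>f\<in>cochains_c E. T' f = ?L f" for T'
      using that sa ext by (intro bounded_operators_eqI[OF G m1]) (auto simp: bounded_self_adjoint_def)
    then show "\<exists>T. bounded_self_adjoint E m\<^sub>1 T \<and> (\<forall>f\<in>cochains_c E. T f = ?L f) \<and>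
        op_norm E m\<^sub>1 (ell2 E m\<^sub>1) T = op_norm E m\<^sub>1 (cochains_c E) ?L \<and>
        (\<forall>T'\<in>bounded_operators E m\<^sub>1. (\<forall>f\<in>cochains_c E. T' f = ?L f) \<longrightarrow> T' = T)"
      using sa ext same_norm by blast
  }
  fix d :: nat
  assume d: "2 \<le> d" and "V \<noteq> {} \<and> regular_graph d V E"
  then have ne: "V \<noteq> {}" and reg: "regular_graph d V E" by auto
  show deg: "max_degree V E = enat d"
    using reg ne by (simp add: max_degree_def regular_graph_def)
  show "op_norm E m\<^sub>1 (cochains_c E) (normalized_Laplacian1 E m\<^sub>0 m\<^sub>1)
      = op_norm E m\<^sub>1 (cochains_c E) ?L"
    by (rule norm_eq)
  show twice: "2 * ennreal_of_enat (max_degree V E) = of_nat (2 * d)"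
    by (simp add: deg)
  have "op_norm E m\<^sub>1 (cochains_c E) ?L \<le> ennreal (real (2 * d - 2) + 2)"
    by (rule op_norm_Laplacian1_le[OF G lf m0 m1 max_degree_line_graph_regular[OF G reg] cc])
  also have "real (2 * d - 2) + 2 = real (2 * d)" using d by simp
  also have "ennreal (real (2 * d)) = 2 * ennreal_of_enat (max_degree V E)"
    unfolding twice by (simp only: ennreal_of_nat_eq_real_of_nat)
  finally show "op_norm E m\<^sub>1 (cochains_c E) ?L \<le> 2 * ennreal_of_enat (max_degree V E)" .
qed

end
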